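(* Let $n\ge1$. There are maps $$\ast:\mathrm{P}\mathrm{P}[n,\widetilde n]\times\mathrm{P}\mathrm{P}[n,\widetilde n]\to\mathrm{P}\mathrm{P}[n,\widetilde n]\qquad\text{and}\qquad\ast:\mathrm{P}\mathrm{P}[n,\widetilde n]\times\mathrm{P}\mathrm{P}[n]\to\mathrm{P}\mathrm{P}[n],$$ turning $\mathrm{P}\mathrm{P}[n,\widetilde n]$ into a $\mathbb{Z}_2$-algebra and $\mathrm{P}\mathrm{P}[n]$ into a module over $\mathrm{P}\mathrm{P}[n,\widetilde n]$, such that the pair $(\mathrm{P}\mathrm{P}[n,\widetilde n],\mathrm{P}\mathrm{P}[n])$ is isomorphic to $\left(\mathrm{End}_{\mathbb{Z}_2}(\mathrm{M}(\mathbb{Z}_2^n,\mathbb{Z}_2)),\mathrm{M}(\mathbb{Z}_2^n,\mathbb{Z}_2)\right)$ via the maps $$A\mapsto\sum_{a\in A}x^{a_1}s^{a_2}\qquad\text{and}\qquad F\mapsto\sum_{a\in F}x^a.$$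
   Context: $\mathbb{Z}_2=\{0,1\}$ is the field with two elements, $[n]=\{1,\dots,n\}$, $\mathrm{P}(y)$ is the set of subsets of $y$, and $\mathrm{P}\mathrm{P}(y)=\mathrm{P}(\mathrm{P}(y))$. $[n,\widetilde n]=\{1,\dots,n,\widetilde1,\dots,\widetilde n\}$ is the disjoint union of two copies of $[n]$; for $a\subseteq[n]$, $\widetilde a=\{\widetilde i\mid i\in a\}$. Each $a\in\mathrm{P}[n,\widetilde n]$ is written uniquely as $a=a_1\sqcup\widetilde a_2$ with $a_1,a_2\in\mathrm{P}[n]$. The additive structure on $\mathrm{P}\mathrm{P}[n,\widetilde n]$ and on $\mathrm{P}\mathrm{P}[n]$ is the symmetric difference $A+B=(A\cup B)\setminus(A\cap B)$. $\mathrm{M}(\mathbb{Z}_2^n,\mathbb{Z}_2)$ is the $\mathbb{Z}_2$-algebra of all maps $\mathbb{Z}_2^n\to\mathbb{Z}_2$; it is a module over its algebra of $\mathbb{Z}_2$-linear endomorphisms $\mathrm{End}_{\mathbb{Z}_2}(\mathrm{M}(\mathbb{Z}_2^n,\mathbb{Z}_2))$ by evaluation. For $a\in\mathrm{P}[n]$, $x^a=\prod_{i\in a}x_i$ is the product of coordinate functions ($x^\emptyset=1$), also viewed as the operator of multiplication by it; $s^a=\prod_{i\in a}s_i$ where $s_if(x)=f(x+e_i)$ is the shift operator and $e_i$ is the vector whose only nonzero entry is at position $i$. Pairs $(A,M)$ consist of a $\mathbb{Z}_2$-algebra $A$ and an $A$-module $M$; a morphism $(f,g):(A_1,M_1)\to(A_2,M_2)$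 consists of $\mathbb{Z}_2$-linear maps $f:A_1\to A_2$, $g:M_1\to M_2$ with $f$ an algebra morphism and $g(am)=f(a)g(m)$. *)

theory Defs
  imports
    "HOL-Algebra.Module"
    "HOL-Algebra.Algebraic_Closure_Type"
    "HOL-Analysis.Finite_Cartesian_Product"
    "HOL-Library.Z2"
begin

section \<open>Algebras, modules over them, and pairs\<close>

definition linear_maps ::
    "('k, 'r) ring_scheme \<Rightarrow> ('k, 'v, 'x) module_scheme \<Rightarrow> ('k, 'w, 'y) module_scheme \<Rightarrow> ('v \<Rightarrow> 'w) set"
  where
  "linear_maps K V W = {g \<in> carrier V \<rightarrow> carrier W.
     (\<forall>u\<in>carrier V. \<forall>v\<in>carrier V. g (u \<oplus>\<^bsub>V\<^esub> v) = g u \<oplus>\<^bsub>W\<^esub> g v) \<and>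
     (\<forall>c\<in>carrier K. \<forall>v\<in>carrier V. g (c \<odot>\<^bsub>V\<^esub> v) = c \<odot>\<^bsub>W\<^esub> g v)}"

text \<open>
  The library locale \<^locale>\<open>algebra\<close> is restricted to commutative algebras; this is its
  associative unital, not necessarily commutative, counterpart.
\<close>

locale assoc_algebra = module K A + ring A for K (structure) and A (structure) +
  assumes smult_mult_left:
    "\<lbrakk>c \<in> carrier K; x \<in> carrier A; y \<in> carrier A\<rbrakk>
      \<Longrightarrow> (c \<odot>\<^bsub>A\<^esub> x) \<otimes>\<^bsub>A\<^esub> y = c \<odot>\<^bsub>A\<^esub> (x \<otimes>\<^bsub>A\<^esub> y)"
  and smult_mult_right:
    "\<lbrakk>c \<in> carrier K; x \<in> carrier A; y \<in> carrier A\<rbrakk>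
      \<Longrightarrow> x \<otimes>\<^bsub>A\<^esub> (c \<odot>\<^bsub>A\<^esub> y) = c \<odot>\<^bsub>A\<^esub> (x \<otimes>\<^bsub>A\<^esub> y)"

text \<open>
  A left module over a \<open>K\<close>-algebra \<open>A\<close>. The operation \<open>\<odot>\<^bsub>M\<^esub>\<close> is multiplication by scalars in \<open>K\<close>;
  the action of \<open>A\<close> is the separate map \<open>act\<close>. The library locale \<^locale>\<open>module\<close> cannot be used
  for the action, since it requires a commutative ring.
\<close>

locale algebra_module = alg: assoc_algebra K A + sp: module K M
  for K :: "('k, 'r) ring_scheme" and A :: "('k, 'a, 'x) module_scheme"
    and M :: "('k, 'm, 'y) module_scheme" +
  fixes act :: "'a \<Rightarrow> 'm \<Rightarrow> 'm"
  assumes act_closed: "\<lbrakk>a \<in> carrier A; m \<in> carrier M\<rbrakk> \<Longrightarrow> act a m \<in> carrier M"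
    and act_add_left: "\<lbrakk>a \<in> carrier A; b \<in> carrier A; m \<in> carrier M\<rbrakk>
      \<Longrightarrow> act (a \<oplus>\<^bsub>A\<^esub> b) m = act a m \<oplus>\<^bsub>M\<^esub> act b m"
    and act_add_right: "\<lbrakk>a \<in> carrier A; m \<in> carrier M; m' \<in> carrier M\<rbrakk>
      \<Longrightarrow> act a (m \<oplus>\<^bsub>M\<^esub> m') = act a m \<oplus>\<^bsub>M\<^esub> act a m'"
    and act_smult_left: "\<lbrakk>c \<in> carrier K; a \<in> carrier A; m \<in> carrier M\<rbrakk>
      \<Longrightarrow> act (c \<odot>\<^bsub>A\<^esub> a) m = c \<odot>\<^bsub>M\<^esub> act a m"
    and act_smult_right: "\<lbrakk>c \<in> carrier K; a \<in> carrier A; m \<in> carrier M\<rbrakk>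
      \<Longrightarrow> act a (c \<odot>\<^bsub>M\<^esub> m) = c \<odot>\<^bsub>M\<^esub> act a m"
    and act_mult: "\<lbrakk>a \<in> carrier A; b \<in> carrier A; m \<in> carrier M\<rbrakk>
      \<Longrightarrow> act (a \<otimes>\<^bsub>A\<^esub> b) m = act a (act b m)"
    and act_one: "m \<in> carrier M \<Longrightarrow> act \<one>\<^bsub>A\<^esub> m = m"

locale pair_morphism =
  dom: algebra_module K A M act + cod: algebra_module K B N act'
  for K :: "('k, 'r) ring_scheme"
    and A :: "('k, 'a, 'x) module_scheme" and M :: "('k, 'm, 'y) module_scheme" and act
    and B :: "('k, 'b, 'z) module_scheme" and N :: "('k, 'n, 'w) module_scheme" and act' +
  fixes f :: "'a \<Rightarrow> 'b" and g :: "'m \<Rightarrow> 'n"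
  assumes f_linear: "f \<in> linear_maps K A B"
    and f_mult: "\<lbrakk>a \<in> carrier A; b \<in> carrier A\<rbrakk> \<Longrightarrow> f (a \<otimes>\<^bsub>A\<^esub> b) = f a \<otimes>\<^bsub>B\<^esub> f b"
    and f_one: "f \<one>\<^bsub>A\<^esub> = \<one>\<^bsub>B\<^esub>"
    and g_linear: "g \<in> linear_maps K M N"
    and g_act: "\<lbrakk>a \<in> carrier A; m \<in> carrier M\<rbrakk> \<Longrightarrow> g (act a m) = act' (f a) (g m)"

definition pair_isomorphism where
  "pair_isomorphism K A M act B N act' f g \<longleftrightarrow>
     pair_morphism K A M act B N act' f g \<and>
     (\<exists>f' g'. pair_morphism K B N act' A M act f' g' \<and>
        (\<forall>a\<in>carrier A. f' (f a) = a) \<and> (\<forall>b\<in>carrier B. f (f' b) = b) \<and>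
        (\<forall>m\<in>carrier M. g' (g m) = m) \<and> (\<forall>n\<in>carrier N. g (g' n) = n))"


section \<open>Functions on $\mathbb{Z}_2^n$ and linear operators on them\<close>

text \<open>
  The index set \<open>[n]\<close> is the universe of a type \<open>'n\<close> of class \<open>finite\<close> (hence nonempty), and
  the disjoint union of two copies of it is the universe of \<open>'n + 'n\<close>, with \<^const>\<open>Inr\<close> giving
  the elements marked by a tilde.
\<close>

abbreviation Z2 :: "bit ring" where
  "Z2 \<equiv> ring_of_type_algebra"

definition fun_algebra :: "(bit, bit ^ 'n \<Rightarrow> bit) module" where
  "fun_algebra = \<lparr>carrier = UNIV,
     monoid.mult = (\<lambda>f g x. f x * g x), one = (\<lambda>x. 1),
     ring.zero = (\<lambda>x. 0), add = (\<lambda>f g x. f x + g x),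
     module.smult = (\<lambda>c f x. c * f x)\<rparr>"

definition End_algebra :: "(bit, (bit ^ 'n \<Rightarrow> bit) \<Rightarrow> (bit ^ 'n \<Rightarrow> bit)) module" where
  "End_algebra = \<lparr>carrier = linear_maps Z2 fun_algebra fun_algebra,
     monoid.mult = (\<circ>), one = id,
     ring.zero = (\<lambda>f x. 0), add = (\<lambda>S T f x. S f x + T f x),
     module.smult = (\<lambda>c T f x. c * T f x)\<rparr>"

definition eval_action :: "((bit ^ 'n \<Rightarrow> bit) \<Rightarrow> (bit ^ 'n \<Rightarrow> bit)) \<Rightarrow> (bit ^ 'n \<Rightarrow> bit) \<Rightarrow> (bit ^ 'n \<Rightarrow> bit)" where
  "eval_action T f = T f"

definition monomial :: "'n set \<Rightarrow> bit ^ 'n \<Rightarrow> bit" where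
  "monomial a = (\<lambda>x. \<Prod>i\<in>a. x $ i)"

definition mult_op :: "(bit ^ 'n \<Rightarrow> bit) \<Rightarrow> (bit ^ 'n \<Rightarrow> bit) \<Rightarrow> (bit ^ 'n \<Rightarrow> bit)" where
  "mult_op h = (\<lambda>f x. h x * f x)"

definition shift :: "'n \<Rightarrow> (bit ^ 'n \<Rightarrow> bit) \<Rightarrow> (bit ^ 'n \<Rightarrow> bit)" where
  "shift i = (\<lambda>f x. f (x + axis i 1))"

text \<open>The shifts commute pairwise, so the fold is the product over \<open>a\<close> in any order.\<close>

definition shift_prod :: "'n set \<Rightarrow> (bit ^ 'n \<Rightarrow> bit) \<Rightarrow> (bit ^ 'n \<Rightarrow> bit)" where
  "shift_prod a = Finite_Set.fold (\<lambda>i T. shift i \<circ> T) id a"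


section \<open>Sets of subsets\<close>

text \<open>
  The set of all subsets of a type as a $\mathbb{Z}_2$-vector space. Addition is symmetric
  difference, and the scalar multiplication is the only possible one. The ring fields \<open>mult\<close>
  and \<open>one\<close>, which \<^locale>\<open>module\<close> ignores, are left unspecified.
\<close>

definition power_space :: "(bit, 'i set) module" where
  "power_space = \<lparr>carrier = UNIV, monoid.mult = undefined, one = undefined,
     ring.zero = {}, add = (\<lambda>A B. (A \<union> B) - (A \<inter> B)),
     module.smult = (\<lambda>c A. if c = 0 then {} else A)\<rparr>"

definition power_algebra :: "('i set \<Rightarrow> 'i set \<Rightarrow> 'i set) \<Rightarrow> 'i set \<Rightarrow> (bit, 'i set) module" where
  "power_algebra star e = power_space\<lparr>monoid.mult := star, one := e\<rparr>"

definition operator_of :: "('n::finite + 'n) set set \<Rightarrow> (bit ^ 'n \<Rightarrow> bit) \<Rightarrow> (bit ^ 'n \<Rightarrow> bit)" where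
  "operator_of A =
     (\<Oplus>\<^bsub>End_algebra\<^esub>a\<in>A. mult_op (monomial (Inl -` a)) \<otimes>\<^bsub>End_algebra\<^esub> shift_prod (Inr -` a))"

definition function_of :: "'n::finite set set \<Rightarrow> bit ^ 'n \<Rightarrow> bit" where
  "function_of F = (\<Oplus>\<^bsub>fun_algebra\<^esub>a\<in>F. monomial a)"

end

theory Submission
  imports Defs
begin

text \<open>
  The content of the theorem is that the two maps are linear bijections: once this is known,
  the product, the unit and the action on sets of subsets are forced to be the ones carried over
  from operators and functions, and every algebra and module law holds because it holds there
  (\<open>assoc_algebra_pullback\<close>, \<open>algebra_module_pullback\<close>, \<open>pair_isomorphism_if_bij\<close>).
  Linearity holds because in characteristic two the terms with index in \<open>A \<inter> B\<close> occur
  twice and cancel, so that a sum over the symmetric difference of \<open>A\<close> and \<open>B\<close> is the sum over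
  \<open>A\<close> plus the sum over \<open>B\<close> (\<open>sum_sym_diff_bit\<close>).

  For functions, bijectivity says that each function on $\mathbb{Z}_2^n$ is a square-free
  polynomial in exactly one way (\<open>bij_function_of\<close>). The kernel is trivial: at the
  characteristic vector of a minimal \<open>b \<in> F\<close>, the only monomial of \<open>F\<close> that does not vanish
  is $x^b$. Surjectivity follows by counting, there being as many sets of subsets as functions.

  For operators, the vectors $x + 1_b$, where $1_b$ is the characteristic vector of \<open>b\<close>, run
  through the whole space as \<open>b\<close> runs through all subsets. Expanding a function in point masses
  therefore shows that a linear operator \<open>T\<close> has the form $Tf(x) = \sum_b k_b(x) f(x + 1_b)$
  with $k_b(x) = T(\delta_{x + 1_b})(x)$, that is, $T = \sum_b k_b s^b$
  (\<open>End_expand\<close>). The same evaluation at point masses recovers the coefficient functions of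
  \<open>operator_of A\<close>, and the coefficient at $s^b$ is the polynomial with exponent set
  \<open>coeff_set A b\<close> (\<open>operator_of_point\<close>). As each $k_b$ is a unique polynomial, \<open>T\<close> comes from a
  unique \<open>A\<close> (\<open>bij_operator_of\<close>).
\<close>

section \<open>Pulling structure back along linear bijections\<close>

lemma linear_mapsD:
  assumes "g \<in> linear_maps K V W" "u \<in> carrier V"
  shows linear_maps_closed: "g u \<in> carrier W"
    and linear_maps_add: "v \<in> carrier V \<Longrightarrow> g (u \<oplus>\<^bsub>V\<^esub> v) = g u \<oplus>\<^bsub>W\<^esub> g v"
    and linear_maps_smult: "c \<in> carrier K \<Longrightarrow> g (c \<odot>\<^bsub>V\<^esub> u) = c \<odot>\<^bsub>W\<^esub> g u"
  using assms unfolding linear_maps_def by blast+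

lemma linear_maps_inv_into:
  assumes "module K V" and f: "f \<in> linear_maps K V W" and bij: "bij_betw f (carrier V) (carrier W)"
  shows "inv_into (carrier V) f \<in> linear_maps K W V"
proof -
  interpret module K V by fact
  let ?g = "inv_into (carrier V) f"
  have closed: "?g w \<in> carrier V" if "w \<in> carrier W" for w
    using bij that by (metis bij_betw_imp_surj_on inv_into_into)
  have right: "f (?g w) = w" if "w \<in> carrier W" for w
    using bij that by (rule bij_betw_inv_into_right)
  have left: "?g (f v) = v" if "v \<in> carrier V" for v
    using bij that by (rule bij_betw_inv_into_left)
  have "?g (w \<oplus>\<^bsub>W\<^esub> w') = ?g w \<oplus>\<^bsub>V\<^esub> ?g w'" if "w \<in> carrier W" "w' \<in> carrier W" for w w'
    using left[of "?g w \<oplus>\<^bsub>V\<^esub> ?g w'"] linear_maps_add[OF f, of "?g w" "?g w'"] that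
    by (simp add: closed right)
  moreover have "?g (c \<odot>\<^bsub>W\<^esub> w) = c \<odot>\<^bsub>V\<^esub> ?g w" if "c \<in> carrier K" "w \<in> carrier W" for c w
    using left[of "c \<odot>\<^bsub>V\<^esub> ?g w"] linear_maps_smult[OF f, of "?g w" c] that
    by (simp add: closed right)
  ultimately show ?thesis
    using closed by (simp add: linear_maps_def)
qed

text \<open>
  Each law is an equation between elements of \<open>A\<close>. Its image under \<open>f\<close> is an instance of the
  same law in \<open>B\<close>, and injectivity of \<open>f\<close> brings it back.
\<close>

lemma assoc_algebra_pullback:
  assumes A: "module K A" and B: "assoc_algebra K B"
    and f: "f \<in> linear_maps K A B" and inj: "inj_on f (carrier A)"
    and mult_closed: "\<And>x y. \<lbrakk>x \<in> carrier A; y \<in> carrier A\<rbrakk> \<Longrightarrow> x \<otimes>\<^bsub>A\<^esub> y \<in> carrier A"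
    and one_closed: "\<one>\<^bsub>A\<^esub> \<in> carrier A"
    and f_mult: "\<And>x y. \<lbrakk>x \<in> carrier A; y \<in> carrier A\<rbrakk> \<Longrightarrow> f (x \<otimes>\<^bsub>A\<^esub> y) = f x \<otimes>\<^bsub>B\<^esub> f y"
    and f_one: "f \<one>\<^bsub>A\<^esub> = \<one>\<^bsub>B\<^esub>"
  shows "assoc_algebra K A"
proof -
  interpret A: module K A by fact
  interpret B: assoc_algebra K B by fact
  note closed = mult_closed one_closed linear_maps_closed[OF f]
  note hom = linear_maps_add[OF f] linear_maps_smult[OF f] f_mult f_one
  have eqI: "x = y" if "f x = f y" "x \<in> carrier A" "y \<in> carrier A" for x y
    using inj that by (rule inj_onD)
  show ?thesis
  proof (intro assoc_algebra.intro assoc_algebra_axioms.intro ringI monoidI A A.abelian_group_axioms)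
  qed (rule eqI; simp add: closed hom B.m_assoc B.l_distr B.r_distr
        B.smult_mult_left B.smult_mult_right | simp add: closed)+
qed

text \<open>
  Every law of an action is an equation in the module, so only \<open>g\<close> has to be injective.
\<close>

lemma algebra_module_pullback:
  assumes A: "assoc_algebra K A" and M: "module K M" and N: "algebra_module K B N act'"
    and f: "f \<in> linear_maps K A B"
    and f_mult: "\<And>x y. \<lbrakk>x \<in> carrier A; y \<in> carrier A\<rbrakk> \<Longrightarrow> f (x \<otimes>\<^bsub>A\<^esub> y) = f x \<otimes>\<^bsub>B\<^esub> f y"
    and f_one: "f \<one>\<^bsub>A\<^esub> = \<one>\<^bsub>B\<^esub>"
    and g: "g \<in> linear_maps K M N" and inj: "inj_on g (carrier M)"
    and act_closed: "\<And>a m. \<lbrakk>a \<in> carrier A; m \<in> carrier M\<rbrakk> \<Longrightarrow> act a m \<in> carrier M"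
    and g_act: "\<And>a m. \<lbrakk>a \<in> carrier A; m \<in> carrier M\<rbrakk> \<Longrightarrow> g (act a m) = act' (f a) (g m)"
  shows "algebra_module K A M act"
proof -
  interpret A: assoc_algebra K A by fact
  interpret M: module K M by fact
  interpret N: algebra_module K B N act' by fact
  note closed = act_closed linear_maps_closed[OF f] linear_maps_closed[OF g]
  note hom = linear_maps_add[OF f] linear_maps_smult[OF f] f_mult f_one
    linear_maps_add[OF g] linear_maps_smult[OF g] g_act
  have eqI: "x = y" if "g x = g y" "x \<in> carrier M" "y \<in> carrier M" for x y
    using inj that by (rule inj_onD)
  show ?thesis
  proof (intro algebra_module.intro algebra_module_axioms.intro A M)
  qed (rule eqI; simp add: closed hom N.act_add_left N.act_add_right N.act_smult_left
        N.act_smult_right N.act_mult N.act_one | simp add: closed)+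
qed

text \<open>The set-theoretic inverses automatically respect all the operations.\<close>

lemma pair_isomorphism_if_bij:
  assumes "pair_morphism K A M act B N act' f g"
    and bij_f: "bij_betw f (carrier A) (carrier B)" and bij_g: "bij_betw g (carrier M) (carrier N)"
  shows "pair_isomorphism K A M act B N act' f g"
proof -
  interpret pair_morphism K A M act B N act' f g by fact
  let ?f = "inv_into (carrier A) f" and ?g = "inv_into (carrier M) g"
  have f': "?f \<in> linear_maps K B A"
    using dom.alg.module_axioms f_linear bij_f by (rule linear_maps_inv_into)
  have g': "?g \<in> linear_maps K N M"
    using dom.sp.module_axioms g_linear bij_g by (rule linear_maps_inv_into)
  note left = bij_betw_inv_into_left[OF bij_f] bij_betw_inv_into_left[OF bij_g]
  note right = bij_betw_inv_into_right[OF bij_f] bij_betw_inv_into_right[OF bij_g]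
  note closed = linear_maps_closed[OF f'] linear_maps_closed[OF g']
  have "pair_morphism K B N act' A M act ?f ?g"
  proof (intro pair_morphism.intro pair_morphism_axioms.intro f' g'
      dom.algebra_module_axioms cod.algebra_module_axioms)
    show "?f (a \<otimes>\<^bsub>B\<^esub> b) = ?f a \<otimes>\<^bsub>A\<^esub> ?f b" if "a \<in> carrier B" "b \<in> carrier B" for a b
      using left(1)[of "?f a \<otimes>\<^bsub>A\<^esub> ?f b"] f_mult[of "?f a" "?f b"] that by (simp add: closed right)
    show "?f \<one>\<^bsub>B\<^esub> = \<one>\<^bsub>A\<^esub>"
      using left(1)[of "\<one>\<^bsub>A\<^esub>"] f_one by simp
    show "?g (act' a m) = act (?f a) (?g m)" if "a \<in> carrier B" "m \<in> carrier N" for a m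
      using left(2)[of "act (?f a) (?g m)"] g_act[of "?f a" "?g m"] that
      by (simp add: closed right dom.act_closed)
  qed
  with assms(1) show ?thesis
    unfolding pair_isomorphism_def using left right by blast
qed


section \<open>The two pairs\<close>

lemma carrier_simps [simp]:
  "carrier Z2 = UNIV" "carrier fun_algebra = UNIV" "carrier power_space = UNIV"
  "carrier (power_algebra star e) = UNIV"
  by (simp_all add: ring_of_type_algebra_def fun_algebra_def power_space_def power_algebra_def)

text \<open>
  Arithmetic in $\mathbb{Z}_2$ is used through the ring laws, so sums and products should not be
  expanded into Boolean connectives.
\<close>

declare add_bit_eq_xor [simp del] mult_bit_eq_and [simp del]

lemma bit_add_self: "c + c = (0::bit)"
  by (cases c) simp_all

lemma module_fun_algebra: "module Z2 (fun_algebra :: (bit, bit ^ 'n \<Rightarrow> bit) module)"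
proof (intro moduleI abelian_groupI cring_from_type_algebra)
  fix f :: "bit ^ 'n \<Rightarrow> bit"
  show "\<exists>g\<in>carrier fun_algebra. g \<oplus>\<^bsub>fun_algebra\<^esub> f = \<zero>\<^bsub>fun_algebra\<^esub>"
    by (rule bexI[of _ f]) (simp_all add: fun_algebra_def bit_add_self fun_eq_iff)
qed (simp_all add: fun_algebra_def ring_of_type_algebra_def fun_eq_iff algebra_simps)

lemma End_carrier_iff:
  "T \<in> carrier End_algebra \<longleftrightarrow>
     (\<forall>f g. T (\<lambda>x. f x + g x) = (\<lambda>x. T f x + T g x)) \<and> (\<forall>c f. T (\<lambda>x. c * f x) = (\<lambda>x. c * T f x))"
  by (simp add: End_algebra_def linear_maps_def)
     (simp add: fun_algebra_def ring_of_type_algebra_def)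

lemma assoc_algebra_End: "assoc_algebra Z2 (End_algebra :: (bit, (bit ^ 'n \<Rightarrow> bit) \<Rightarrow> _) module)"
proof -
  let ?E = "End_algebra :: (bit, (bit ^ 'n \<Rightarrow> bit) \<Rightarrow> (bit ^ 'n \<Rightarrow> bit)) module"
  have ops: "S \<oplus>\<^bsub>?E\<^esub> T = (\<lambda>f x. S f x + T f x)" "S \<otimes>\<^bsub>?E\<^esub> T = S \<circ> T" "\<one>\<^bsub>?E\<^esub> = id"
    "\<zero>\<^bsub>?E\<^esub> = (\<lambda>f x. 0)" "c \<odot>\<^bsub>?E\<^esub> T = (\<lambda>f x. c * T f x)" for S T c
    by (simp_all add: End_algebra_def)
  have ab: "abelian_group ?E"
  proof (rule abelian_groupI)
    fix T assume "T \<in> carrier ?E"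
    then show "\<exists>S\<in>carrier ?E. S \<oplus>\<^bsub>?E\<^esub> T = \<zero>\<^bsub>?E\<^esub>"
      by (intro bexI[of _ T]) (simp_all add: ops bit_add_self)
  qed (simp_all add: ops End_carrier_iff algebra_simps)
  have "module Z2 ?E"
    by (intro moduleI ab cring_from_type_algebra)
       (simp_all add: ops End_carrier_iff ring_of_type_algebra_def algebra_simps)
  moreover have "ring ?E"
    by (intro ringI ab monoidI) (simp_all add: ops End_carrier_iff o_def)
  ultimately show ?thesis
    by (intro assoc_algebra.intro assoc_algebra_axioms.intro)
       (simp_all add: ops End_carrier_iff o_def)
qed

lemma algebra_module_End:
  "algebra_module Z2 End_algebra (fun_algebra :: (bit, bit ^ 'n \<Rightarrow> bit) module) eval_action"
proof (intro algebra_module.intro algebra_module_axioms.intro assoc_algebra_End module_fun_algebra)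
qed (simp_all add: End_carrier_iff eval_action_def,
     simp_all add: End_algebra_def fun_algebra_def)

text \<open>
  The two records on sets of subsets differ only in their multiplicative fields, so the vector
  space axioms are derived once from the additive fields.
\<close>

lemma module_power_space_if:
  fixes A :: "(bit, 'i set) module"
  assumes "carrier A = UNIV" "add A = (\<lambda>P Q. (P \<union> Q) - (P \<inter> Q))" "ring.zero A = {}"
    "module.smult A = (\<lambda>c P. if c = 0 then {} else P)"
  shows "module Z2 A"
proof (intro moduleI abelian_groupI cring_from_type_algebra)
  show "\<exists>Q\<in>carrier A. Q \<oplus>\<^bsub>A\<^esub> P = \<zero>\<^bsub>A\<^esub>" for P
    by (rule bexI[of _ P]) (simp_all add: assms)
  show "(a \<oplus>\<^bsub>Z2\<^esub> b) \<odot>\<^bsub>A\<^esub> P = a \<odot>\<^bsub>A\<^esub> P \<oplus>\<^bsub>A\<^esub> b \<odot>\<^bsub>A\<^esub> P" for a b :: bit and P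
    by (cases a; cases b) (simp_all add: assms ring_of_type_algebra_def)
qed (auto simp: assms ring_of_type_algebra_def)

lemma module_power_algebra: "module Z2 (power_algebra star e)"
  by (rule module_power_space_if) (simp_all add: power_algebra_def power_space_def)

lemma module_power_space: "module Z2 power_space"
  by (rule module_power_space_if) (simp_all add: power_space_def)


section \<open>Functions as polynomials\<close>

text \<open>
  The sum over \<open>A\<close> plus the sum over \<open>B\<close> counts the elements of \<open>A \<inter> B\<close> twice, hence not at
  all in characteristic two.
\<close>

lemma sum_sym_diff_bit:
  fixes h :: "'a \<Rightarrow> bit"
  assumes "finite A" "finite B"
  shows "sum h ((A \<union> B) - (A \<inter> B)) = sum h A + sum h B"
proof -
  have "sum h A + sum h B = sum h (A \<union> B) + sum h (A \<inter> B)"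
    using assms by (rule sum.union_inter[symmetric])
  also have "sum h (A \<union> B) = sum h ((A \<union> B) - (A \<inter> B)) + sum h (A \<inter> B)"
    using assms by (intro sum.subset_diff) auto
  finally show ?thesis
    by (simp add: add.assoc bit_add_self)
qed

lemma function_of_eq_sum: "function_of F x = (\<Sum>a\<in>F. monomial a x)"
proof -
  interpret module Z2 "fun_algebra :: (bit, bit ^ 'a \<Rightarrow> bit) module" by (rule module_fun_algebra)
  have "finite F" by simp
  then show ?thesis
    unfolding function_of_def
    by induction (simp_all add: M.finsum_insert, simp_all add: fun_algebra_def)
qed

lemma function_of_linear:
  "(function_of :: 'n::finite set set \<Rightarrow> _) \<in> linear_maps Z2 power_space fun_algebra"
proof -
  have "function_of ((F \<union> G) - (F \<inter> G)) = (\<lambda>x. function_of F x + function_of G x)"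
    for F G :: "'n::finite set set"
    by (rule ext) (simp only: function_of_eq_sum sum_sym_diff_bit[OF finite finite])
  moreover have "function_of (if c = 0 then {} else F) = (\<lambda>x. c * function_of F x)"
    for c and F :: "'n::finite set set"
    by (rule ext, cases c) (simp_all add: function_of_eq_sum)
  ultimately show ?thesis
    by (simp add: linear_maps_def split del: if_split)
       (simp add: fun_algebra_def power_space_def split del: if_split)
qed

definition char_vec :: "'n set \<Rightarrow> bit ^ 'n" where
  "char_vec b = (\<chi> i. if i \<in> b then 1 else 0)"

lemma char_vec_support: "char_vec {i. x $ i = 1} = x"
  by (simp add: char_vec_def vec_eq_iff)

text \<open>
  Thus the value of a polynomial at $1_b$ is the parity of the number of its exponents
  below \<open>b\<close>.
\<close>

lemma monomial_char_vec: "monomial a (char_vec b) = (if a \<subseteq> b then 1 else 0)"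
  for a :: "'n::finite set"
  by (auto simp: monomial_def char_vec_def intro!: prod.neutral)

text \<open>
  The map is additive, so two sets with the same function have a symmetric difference \<open>D\<close>
  representing the zero function. A minimal element \<open>b\<close> of \<open>D\<close> is the only exponent in \<open>D\<close>
  below \<open>b\<close>, which makes the value at $1_b$ equal to one.
\<close>

lemma inj_function_of: "inj (function_of :: 'n::finite set set \<Rightarrow> _)"
proof (rule injI)
  fix F G :: "'n set set"
  assume eq: "function_of F = function_of G"
  define D where "D = (F \<union> G) - (F \<inter> G)"
  have zero: "function_of D x = 0" for x
    unfolding D_def function_of_eq_sum sum_sym_diff_bit[OF finite finite]
    using fun_cong[OF eq, of x] by (simp only: function_of_eq_sum bit_add_self)
  have "D = {}"
  proof (rule ccontr)
    assume "D \<noteq> {}"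
    then obtain b where b: "b \<in> D" and min: "\<And>a. a \<in> D \<Longrightarrow> a \<subseteq> b \<Longrightarrow> a = b"
      using finite_has_minimal[of D] by auto
    have "function_of D (char_vec b) = (\<Sum>a\<in>D. if a = b then 1 else 0)"
      unfolding function_of_eq_sum monomial_char_vec
      by (intro sum.cong refl) (use min in auto)
    also have "\<dots> = 1"
      using b by simp
    finally show False
      by (simp add: zero)
  qed
  then show "F = G"
    unfolding D_def by blast
qed

text \<open>
  A function is determined by the set of those \<open>b\<close> for which its value at $1_b$ is one. Composing
  with this encoding gives an injective self-map of a finite set, which is onto.
\<close>

lemma bij_function_of: "bij (function_of :: 'n::finite set set \<Rightarrow> _)"
proof -
  define ones where "ones h = {b. h (char_vec b) = 1}" for h :: "bit ^ 'n \<Rightarrow> bit"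
  have inj_ones: "inj ones"
  proof (rule injI)
    fix h k assume eq: "ones h = ones k"
    show "h = k"
    proof
      fix x
      have "(h x = 1) = (k x = 1)"
        using eq char_vec_support[of x] unfolding ones_def by (metis (mono_tags) mem_Collect_eq)
      then show "h x = k x"
        by (cases "h x"; cases "k x") simp_all
    qed
  qed
  have "inj (ones \<circ> function_of)"
    using inj_ones inj_function_of by (rule inj_compose)
  then have "surj (ones \<circ> function_of)"
    by (intro finite_UNIV_inj_surj) simp_all
  have "h \<in> range function_of" for h :: "bit ^ 'n \<Rightarrow> bit"
  proof -
    obtain F where "ones h = ones (function_of F)"
      using \<open>surj (ones \<circ> function_of)\<close> unfolding surj_def by auto
    then show ?thesis
      using inj_ones by (auto dest: injD)
  qed
  then show ?thesis
    using inj_function_of by (auto simp: bij_def)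
qed


section \<open>Operators as polynomials in coordinates and shifts\<close>

text \<open>Shifts commute, and the distinct basis vectors indexed by \<open>b\<close> add up to $1_b$.\<close>

lemma shift_prod_eq: "shift_prod b f x = f (x + char_vec b)"
  for b :: "'n::finite set"
proof -
  interpret comp_fun_commute "\<lambda>(i::'n) T. shift i \<circ> T"
    by standard (simp add: fun_eq_iff shift_def add_ac)
  have "finite b" by simp
  then show ?thesis
  proof (induction b arbitrary: f x)
    case empty
    then show ?case
      by (simp add: shift_prod_def char_vec_def zero_vec_def[symmetric])
  next
    case (insert i b)
    have "axis i 1 + char_vec b = char_vec (insert i b)"
      using insert.hyps by (auto simp: vec_eq_iff axis_def char_vec_def)
    moreover have "shift_prod (insert i b) = shift i \<circ> shift_prod b"
      unfolding shift_prod_def using insert.hyps by (rule fold_insert)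
    ultimately show ?case
      by (simp add: insert.IH shift_def add.assoc)
  qed
qed

lemma
  fixes A :: "('n::finite + 'n) set set"
  shows operator_of_eq_sum: "operator_of A f x = (\<Sum>a\<in>A. monomial (Inl -` a) x * f (x + char_vec (Inr -` a)))"
    and operator_of_closed: "operator_of A \<in> carrier End_algebra"
proof -
  interpret E: assoc_algebra Z2 "End_algebra :: (bit, (bit ^ 'n \<Rightarrow> bit) \<Rightarrow> _) module"
    by (rule assoc_algebra_End)
  let ?t = "\<lambda>a. mult_op (monomial (Inl -` a)) \<otimes>\<^bsub>End_algebra\<^esub> shift_prod (Inr -` a)"
  have t: "?t a = (\<lambda>f x. monomial (Inl -` a) x * f (x + char_vec (Inr -` a)))"
    for a :: "('n + 'n) set"
    by (simp add: End_algebra_def mult_op_def shift_prod_eq o_def)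
  have closed: "?t a \<in> carrier End_algebra" for a :: "('n + 'n) set"
    by (simp add: t End_carrier_iff algebra_simps)
  show "operator_of A \<in> carrier End_algebra"
    unfolding operator_of_def by (intro E.finsum_closed) (use closed in auto)
  have "finite A" by simp
  then show "operator_of A f x = (\<Sum>a\<in>A. monomial (Inl -` a) x * f (x + char_vec (Inr -` a)))"
    unfolding operator_of_def
  proof induction
    case empty
    then show ?case by (simp, simp add: End_algebra_def)
  next
    case (insert a A)
    have "(\<Oplus>\<^bsub>End_algebra\<^esub>a\<in>insert a A. ?t a) = ?t a \<oplus>\<^bsub>End_algebra\<^esub> (\<Oplus>\<^bsub>End_algebra\<^esub>a\<in>A. ?t a)"
      by (intro E.finsum_insert) (use insert closed in auto)
    then show ?case
      using insert unfolding t by (simp add: End_algebra_def)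
  qed
qed

lemma operator_of_linear:
  "(operator_of :: ('n::finite + 'n) set set \<Rightarrow> _) \<in> linear_maps Z2 (power_algebra star e) End_algebra"
proof -
  have "operator_of ((A \<union> B) - (A \<inter> B)) = (\<lambda>f x. operator_of A f x + operator_of B f x)"
    for A B :: "('n::finite + 'n) set set"
    by (intro ext) (simp only: operator_of_eq_sum sum_sym_diff_bit[OF finite finite])
  moreover have "operator_of (if c = 0 then {} else A) = (\<lambda>f x. c * operator_of A f x)"
    for c and A :: "('n::finite + 'n) set set"
    by (intro ext, cases c) (simp_all add: operator_of_eq_sum)
  ultimately show ?thesis
    by (simp add: linear_maps_def operator_of_closed split del: if_split)
       (simp add: power_algebra_def power_space_def End_algebra_def split del: if_split)
qed

definition point :: "bit ^ 'n \<Rightarrow> bit ^ 'n \<Rightarrow> bit" where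
  "point y x = (if x = y then 1 else 0)"

text \<open>The exponents of the polynomial that stands in front of $s^b$ in the operator of \<open>A\<close>.\<close>

definition coeff_set :: "('n + 'n) set set \<Rightarrow> 'n set \<Rightarrow> 'n set set" where
  "coeff_set A b = {c. c <+> b \<in> A}"

lemma vimage_Plus: "Inl -` (c <+> b) = c" "Inr -` (c <+> b) = b"
  by auto

lemma vimage_Plus_vimage: "Inl -` a <+> Inr -` a = a"
proof -
  have "x \<in> Inl -` a <+> Inr -` a \<longleftrightarrow> x \<in> a" for x
    by (cases x) auto
  then show ?thesis
    by blast
qed

lemma vec_bit_add_self: "x + x = (0 :: bit ^ 'n)"
  by (simp add: vec_eq_iff)

lemma inj_char_vec: "inj char_vec"
  by (rule injI) (auto simp: char_vec_def vec_eq_iff split: if_splits)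

text \<open>
  At \<open>x\<close>, a term of the operator with shift $s^c$ reads its argument at $x + 1_c$. The point mass
  at $x + 1_b$ thus selects the terms with \<open>c = b\<close>, which expresses the coefficient functions
  through the operator.
\<close>

lemma operator_of_point:
  "operator_of A (point (x + char_vec b)) x = function_of (coeff_set A b) x"
  for A :: "('n::finite + 'n) set set"
proof -
  have "operator_of A (point (x + char_vec b)) x
      = (\<Sum>a\<in>A. if Inr -` a = b then monomial (Inl -` a) x else 0)"
    unfolding operator_of_eq_sum point_def
    by (intro sum.cong refl) (simp add: inj_eq[OF inj_char_vec])
  also have "\<dots> = (\<Sum>a | a \<in> A \<and> Inr -` a = b. monomial (Inl -` a) x)"
    by (simp add: sum.inter_filter)
  also have "\<dots> = (\<Sum>c\<in>coeff_set A b. monomial c x)"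
  proof (rule sum.reindex_bij_witness[where j = "\<lambda>a. Inl -` a" and i = "\<lambda>c. c <+> b"])
    fix a assume "a \<in> {a. a \<in> A \<and> Inr -` a = b}"
    then show "Inl -` a <+> b = a" "Inl -` a \<in> coeff_set A b"
      using vimage_Plus_vimage[of a] by (simp_all add: coeff_set_def)
  qed (simp_all add: coeff_set_def vimage_Plus)
  finally show ?thesis
    by (simp add: function_of_eq_sum)
qed

lemma End_sum:
  assumes T: "T \<in> carrier End_algebra" and "finite S"
  shows "T (\<lambda>x. \<Sum>i\<in>S. c i * h i x) = (\<lambda>x. \<Sum>i\<in>S. c i * T (h i) x)"
  using assms(2)
proof induction
  case empty
  \<comment> \<open>The zero function is written as zero times an arbitrary one to apply homogeneity.\<close>
  have "T (\<lambda>x. 0 * undefined x) = (\<lambda>x. 0 * T undefined x)"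
    using T unfolding End_carrier_iff by blast
  then show ?case by simp
next
  case (insert i S)
  then show ?case
    using T by (simp add: End_carrier_iff)
qed

text \<open>
  This is the matrix of \<open>T\<close> in the basis of point masses, with the columns relabelled by their
  displacement from \<open>x\<close>, so that row \<open>x\<close> becomes a combination of shifts evaluated at \<open>x\<close>.
\<close>

lemma End_expand:
  fixes T :: "(bit ^ 'n::finite \<Rightarrow> bit) \<Rightarrow> (bit ^ 'n \<Rightarrow> bit)"
  assumes T: "T \<in> carrier End_algebra"
  shows "T f x = (\<Sum>b\<in>UNIV. f (x + char_vec b) * T (point (x + char_vec b)) x)"
proof -
  have bij: "bij (\<lambda>b. x + char_vec b)"
  proof (rule bijI)
    show "inj (\<lambda>b. x + char_vec b)"
      using inj_char_vec by (auto simp: inj_def)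
    show "surj (\<lambda>b. x + char_vec b)"
      using char_vec_support[of "_ + x"] unfolding surj_def 
      by (metis add.assoc add.commute add_0 vec_bit_add_self)
  qed
  have "f = (\<lambda>z. \<Sum>b\<in>UNIV. f (x + char_vec b) * point (x + char_vec b) z)"
  proof
    fix z
    obtain b where b: "z = x + char_vec b"
      using bij by (metis bij_pointE)
    show "f z = (\<Sum>b\<in>UNIV. f (x + char_vec b) * point (x + char_vec b) z)"
      unfolding b point_def by (simp add: inj_eq[OF inj_char_vec] if_distrib cong: if_cong)
  qed
  then have "T f = T (\<lambda>z. \<Sum>b\<in>UNIV. f (x + char_vec b) * point (x + char_vec b) z)"
    by simp
  also have "\<dots> = (\<lambda>z. \<Sum>b\<in>UNIV. f (x + char_vec b) * T (point (x + char_vec b)) z)"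
    using T by (rule End_sum) simp
  finally show ?thesis by (rule fun_cong)
qed

text \<open>
  Both an operator and its set of exponents amount to one coefficient per shift $s^b$, a function
  on one side and a set of subsets on the other; \<open>bij_function_of\<close> matches the two.
\<close>

lemma bij_operator_of:
  "bij_betw operator_of (UNIV :: ('n::finite + 'n) set set set) (carrier End_algebra)"
proof (rule bij_betw_imageI)
  show "inj (operator_of :: ('n + 'n) set set \<Rightarrow> _)"
  proof (rule injI)
    fix A B :: "('n + 'n) set set"
    assume "operator_of A = operator_of B"
    then have "function_of (coeff_set A b) = function_of (coeff_set B b)" for b
      by (intro ext) (simp only: operator_of_point[symmetric])
    then have coeff: "coeff_set A b = coeff_set B b" for b
      by (rule injD[OF inj_function_of])
    have "c <+> b \<in> A \<longleftrightarrow> c <+> b \<in> B" for b c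
      using coeff[of b] unfolding coeff_set_def by blast
    then have "a \<in> A \<longleftrightarrow> a \<in> B" for a
      using vimage_Plus_vimage[of a] by metis
    then show "A = B"
      by blast
  qed
next
  show "operator_of ` (UNIV :: ('n + 'n) set set set) = carrier End_algebra"
  proof (intro equalityI subsetI)
    fix T :: "(bit ^ 'n \<Rightarrow> bit) \<Rightarrow> (bit ^ 'n \<Rightarrow> bit)"
    assume T: "T \<in> carrier End_algebra"
    define F where "F b = inv_into UNIV function_of (\<lambda>x. T (point (x + char_vec b)) x)" for b
    have F: "function_of (F b) = (\<lambda>x. T (point (x + char_vec b)) x)" for b
      unfolding F_def using bij_is_surj[OF bij_function_of] by (rule surj_f_inv_f)
    define A where "A = {a. Inl -` a \<in> F (Inr -` a)}"
    have "coeff_set A b = F b" for b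
      by (simp add: coeff_set_def A_def vimage_Plus)
    then have "operator_of A (point (x + char_vec b)) x = T (point (x + char_vec b)) x" for b x
      by (simp add: operator_of_point F)
    then have "operator_of A f x = T f x" for f x
      unfolding End_expand[OF T, of f x] End_expand[OF operator_of_closed, of A f x] by simp
    then have "operator_of A = T"
      by (intro ext)
    then show "T \<in> range operator_of"
      by blast
  qed (auto simp: operator_of_closed)
qed


section \<open>The isomorphism of pairs\<close>

theorem theorem56:
  shows "\<exists>(star :: ('n::finite + 'n) set set \<Rightarrow> ('n + 'n) set set \<Rightarrow> ('n + 'n) set set)
          (e :: ('n + 'n) set set)
          (act :: ('n + 'n) set set \<Rightarrow> 'n set set \<Rightarrow> 'n set set).
    assoc_algebra Z2 (power_algebra star e) \<and>
    algebra_module Z2 (power_algebra star e) power_space act \<and>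
    pair_isomorphism Z2
      (power_algebra star e) power_space act
      End_algebra fun_algebra eval_action
      operator_of function_of"
proof -
  let ?E = "End_algebra :: (bit, (bit ^ 'n \<Rightarrow> bit) \<Rightarrow> (bit ^ 'n \<Rightarrow> bit)) module"
  interpret E: assoc_algebra Z2 ?E by (rule assoc_algebra_End)
  define star where
    "star A B = inv_into UNIV operator_of (operator_of A \<otimes>\<^bsub>?E\<^esub> operator_of B)" for A B :: "('n + 'n) set set"
  define e :: "('n + 'n) set set" where "e = inv_into UNIV operator_of \<one>\<^bsub>?E\<^esub>"
  define act where
    "act A F = inv_into UNIV function_of (eval_action (operator_of A) (function_of F))"
    for A :: "('n + 'n) set set" and F :: "'n set set"
  let ?A = "power_algebra star e"
  have op_inv: "operator_of (inv_into UNIV operator_of T) = T" if "T \<in> carrier ?E" for T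
    using bij_operator_of that by (rule bij_betw_inv_into_right)
  have fun_inv: "function_of (inv_into UNIV function_of h) = h" for h :: "bit ^ 'n \<Rightarrow> bit"
    using bij_is_surj[OF bij_function_of] by (rule surj_f_inv_f)
  have bij_op: "bij_betw operator_of (carrier ?A) (carrier ?E)"
    using bij_operator_of by simp
  have bij_fun: "bij_betw function_of (carrier (power_space :: (bit, 'n set set) module))
      (carrier fun_algebra)"
    using bij_function_of by simp
  have mult: "operator_of (A \<otimes>\<^bsub>?A\<^esub> B) = operator_of A \<otimes>\<^bsub>?E\<^esub> operator_of B" for A B
    using op_inv[OF E.m_closed[OF operator_of_closed operator_of_closed]]
    by (simp add: power_algebra_def star_def)
  have one: "operator_of \<one>\<^bsub>?A\<^esub> = \<one>\<^bsub>?E\<^esub>"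
    using op_inv[OF E.one_closed] by (simp add: power_algebra_def e_def)
  have action: "function_of (act A F) = eval_action (operator_of A) (function_of F)" for A F
    by (simp add: act_def fun_inv)
  have alg: "assoc_algebra Z2 ?A"
    using module_power_algebra assoc_algebra_End operator_of_linear bij_betw_imp_inj_on[OF bij_op]
    by (rule assoc_algebra_pullback) (simp_all add: mult one)
  have algmod: "algebra_module Z2 ?A power_space act"
    using alg module_power_space algebra_module_End operator_of_linear mult one function_of_linear
      bij_betw_imp_inj_on[OF bij_fun]
    by (rule algebra_module_pullback) (simp_all add: action)
  have "pair_morphism Z2 ?A power_space act ?E fun_algebra eval_action operator_of function_of"
    by (intro pair_morphism.intro pair_morphism_axioms.intro algmod algebra_module_End
        operator_of_linear function_of_linear mult one action)
  then have "pair_isomorphism Z2 ?A power_space act ?E fun_algebra eval_action operator_of function_of"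
    using bij_op bij_fun by (rule pair_isomorphism_if_bij)
  with alg algmod show ?thesis
    by blast
qed

end
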